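(* Let $A$ and $B$ be (complex) Hermitian matrices of size $n\times n$, and assume that $A$ has rank one. Then the function $f_{A,B}:\mathbb{R}\to\mathbb{R}$ defined by $$f_{A,B}(t)=\operatorname{trace}\{\exp[tA+B]\},\qquad t\in\mathbb{R},$$ is exponentially convex.
   Context: A function $f:\mathbb{R}\to[0,\infty)$ is said to be exponentially convex if (1) for every nonnegative integer $N$, every choice of real numbers $t_1,\dots,t_N$ and complex numbers $\xi_1,\dots,\xi_N$, the inequality $\sum_{r,s=1}^{N} f(t_r+t_s)\,\xi_r\overline{\xi_s}\ge 0$ holds; and (2) $f$ is continuous on $\mathbb{R}$. Here $\exp$ denotes the matrix exponential. *)

theory Defs
  imports "HOL-Analysis.Analysis"
begin

definition hermitian_matrix :: "complex^'n^'n \<Rightarrow> bool" where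
  "hermitian_matrix A \<longleftrightarrow> map_matrix cnj (transpose A) = A"

text \<open>
  The type \<^typ>\<open>complex^'n^'n\<close> carries the entrywise product as its \<^const>\<open>times\<close>, so
  neither the library's power nor its \<^const>\<open>exp\<close> can be used; the power and the
  exponential series below are taken with respect to matrix multiplication \<open>**\<close>. The series
  converges absolutely for every matrix.
\<close>

definition matrix_power :: "complex^'n^'n \<Rightarrow> nat \<Rightarrow> complex^'n^'n" where
  "matrix_power A k = (((**) A) ^^ k) (mat 1)"

definition matrix_exp :: "complex^'n^'n \<Rightarrow> complex^'n^'n" where
  "matrix_exp A = (\<Sum>k. matrix_power A k /\<^sub>R fact k)"

text \<open>
  Membership of the complex sum in \<open>\<real>\<^sub>\<ge>\<^sub>0\<close> says that it is real and nonnegative.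
\<close>

definition exponentially_convex :: "(real \<Rightarrow> real) \<Rightarrow> bool" where
  "exponentially_convex f \<longleftrightarrow>
     (\<forall>t. 0 \<le> f t) \<and>
     (\<forall>(N::nat) (t :: nat \<Rightarrow> real) (\<xi> :: nat \<Rightarrow> complex).
        (\<Sum>r=1..N. \<Sum>s=1..N. complex_of_real (f (t r + t s)) * \<xi> r * cnj (\<xi> s)) \<in> \<real>\<^sub>\<ge>\<^sub>0) \<and>
     continuous_on UNIV f"

end

theory Submission
  imports Defs
begin

text \<open>
  A Hermitian matrix of rank one is \<open>A = a P\<close> with \<open>a\<close> real and \<open>P = v v\<^sup>*\<close> the projection onto a
  unit vector \<open>v\<close>. Put \<open>Q = 1 - P\<close> and \<open>C = (1 + B / (2m))\<^sup>2\<close>. Since \<open>exp (t A / m) = z P + Q\<close> with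
  \<open>z = exp (a t / m)\<close>, and \<open>C\<close> agrees with \<open>exp (B / m)\<close> up to \<open>O(1 / m\<^sup>2)\<close>, a Lie-Trotter argument
  (lemma \<open>tendsto_trace_matrix_exp_product\<close>) gives
  \<open>trace (exp (t A + B)) = lim\<^sub>m trace (((z P + Q) C)\<^sup>m)\<close>.

  Each approximating trace is a polynomial in \<open>z\<close>, and its coefficients are nonnegative. Indeed it is a
  sum over words in \<open>P C\<close> and \<open>Q C\<close>. Because \<open>P X P = trace (X P) P\<close>, the trace of a word containing
  \<open>P\<close> factors, up to cyclic rotation, into numbers of the form \<open>trace (C (Q C)\<^sup>l P) = v\<^sup>* C (Q C)\<^sup>l v\<close>.
  Such an alternating product \<open>C Q C \<dots> Q C\<close> is palindromic, hence congruent to its middle factor,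
  which is \<open>C\<close> or \<open>Q\<close>; as both are positive semidefinite, so is the product
  (lemma \<open>psd_alternating_power\<close>). Rank one is what turns the blocks \<open>P C (Q C)\<^sup>l P\<close> into
  numbers: for a projection \<open>P\<close> of higher rank they are positive semidefinite matrices, whose products
  can have a trace that is not nonnegative.

  Rather than handling polynomials in \<open>z\<close>, the proof works with the cone of functions whose kernel
  \<open>f (t\<^sub>r + t\<^sub>s)\<close> is positive semidefinite. It contains the nonnegative constants and is closed under
  addition, multiplication by \<open>exp (h t)\<close> and pointwise limits; this is all that is needed to run the
  expansion over words as two recursions on the power (lemmas \<open>exp_convex_kernel_corner\<close> and
  \<open>exp_convex_kernel_trace_power\<close>) and then to let \<open>m\<close> tend to infinity. Nonnegativity and
  realness of the function also survive the limit. Continuity comes, like the product formula, from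
  dominated convergence in the exponential series (lemma \<open>tendsto_trace_matrix_exp_weighted\<close>).
\<close>

section \<open>Matrix algebra\<close>

abbreviation adj :: "complex^'n^'n \<Rightarrow> complex^'n^'n" where
  "adj M \<equiv> map_matrix cnj (transpose M)"

lemma matrix_add_rdistrib: "(A + B) ** C = A ** C + B ** C"
  for A B C :: "complex^'n^'n"
  by (vector matrix_matrix_mult_def sum.distrib[symmetric] field_simps)

lemma matrix_mult_scaleR:
  fixes A B :: "complex^'n^'n"
  shows "(c *\<^sub>R A) ** B = c *\<^sub>R (A ** B)" and "A ** (c *\<^sub>R B) = c *\<^sub>R (A ** B)"
  using matrix_scalar_ac[of A c B] by (simp_all add: scalar_matrix_assoc)

lemma adj_mult: "adj (A ** B) = adj B ** adj A" for A B :: "complex^'n^'n"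
  by (simp add: vec_eq_iff transpose_def matrix_matrix_mult_def mult.commute)

lemma hermitian_mat_1: "hermitian_matrix (mat 1)"
  by (simp add: hermitian_matrix_def vec_eq_iff transpose_def mat_def)

lemma hermitian_add:
  "hermitian_matrix A \<Longrightarrow> hermitian_matrix B \<Longrightarrow> hermitian_matrix (A + B)"
  by (simp add: hermitian_matrix_def vec_eq_iff transpose_def)

lemma hermitian_scaleR: "hermitian_matrix A \<Longrightarrow> hermitian_matrix (c *\<^sub>R A)"
  by (simp add: hermitian_matrix_def vec_eq_iff transpose_def)

lemma hermitian_minus:
  "hermitian_matrix A \<Longrightarrow> hermitian_matrix B \<Longrightarrow> hermitian_matrix (A - B)"
  by (simp add: hermitian_matrix_def vec_eq_iff transpose_def)

lemma trace_scaleR: "trace (c *\<^sub>R A) = complex_of_real c * trace A" for A :: "complex^'n^'n"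
  by (simp add: trace_def scaleR_conv_of_real[where 'a=complex] sum_distrib_left)

lemma trace_sum: "trace (\<Sum>k\<in>K. f k) = (\<Sum>k\<in>K. trace (f k))" for f :: "'a \<Rightarrow> complex^'n^'n"
  by (induction K rule: infinite_finite_induct) (simp_all add: trace_add trace_0 flip: mat_0)

lemma matrix_mult_sum_right: "A ** (\<Sum>k\<in>K. f k) = (\<Sum>k\<in>K. A ** f k)"
  for A :: "complex^'n^'n"
  by (induction K rule: infinite_finite_induct) (simp_all add: matrix_add_ldistrib)

lemma matrix_power_0 [simp]: "matrix_power A 0 = mat 1"
  by (simp add: matrix_power_def)

lemma matrix_power_Suc [simp]: "matrix_power A (Suc k) = A ** matrix_power A k"
  by (simp add: matrix_power_def)

lemma matrix_power_Suc_right: "matrix_power A (Suc k) = matrix_power A k ** A"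
  by (induction k) (simp_all add: matrix_mul_assoc)

lemma matrix_power_scaleR: "matrix_power (c *\<^sub>R A) k = c ^ k *\<^sub>R matrix_power A k"
  by (induction k) (simp_all add: matrix_mult_scaleR)

lemma matrix_power_one_plus:
  "matrix_power (mat 1 + A) m = (\<Sum>k\<le>m. real (m choose k) *\<^sub>R matrix_power A k)"
proof (induction m)
  case 0
  show ?case by simp
next
  case (Suc m)
  let ?p = "matrix_power A"
  \<comment> \<open>The vanishing top term makes room for Pascal's rule after an index shift.\<close>
  have shift: "(\<Sum>k\<le>Suc m. real (m choose k) *\<^sub>R ?p k) = (\<Sum>k\<le>m. real (m choose k) *\<^sub>R ?p k)"
    by simp
  have "matrix_power (mat 1 + A) (Suc m)
      = (\<Sum>k\<le>m. real (m choose k) *\<^sub>R ?p k) + (\<Sum>k\<le>m. real (m choose k) *\<^sub>R ?p (Suc k))"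
    by (simp only: matrix_power_Suc Suc matrix_add_rdistrib matrix_mul_lid)
      (simp add: matrix_mult_sum_right matrix_mult_scaleR)
  also have "\<dots> = (\<Sum>k\<le>Suc m. real (Suc m choose k) *\<^sub>R ?p k)"
    unfolding shift[symmetric] sum.atMost_Suc_shift
    by (simp add: sum.distrib[symmetric] scaleR_add_left[symmetric] add.commute)
  finally show ?case .
qed

section \<open>Traces of exponentials as limits\<close>

lemma norm_matrix_power_entry_le:
  fixes A :: "complex^'n^'n"
  assumes "norm A \<le> K"
  shows "norm (matrix_power A k $ i $ j) \<le> (real CARD('n) * K) ^ k"
proof (induction k arbitrary: i)
  case 0
  show ?case by (simp add: mat_def)
next
  case (Suc k)
  have entry: "norm (A $ i $ l) \<le> K" for l
    using assms Finite_Cartesian_Product.norm_nth_le[of "A $ i" l]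
      Finite_Cartesian_Product.norm_nth_le[of A i] by linarith
  have K: "0 \<le> K" using assms norm_ge_zero order_trans by blast
  have "norm (matrix_power A (Suc k) $ i $ j)
      \<le> (\<Sum>l\<in>UNIV. norm (A $ i $ l * matrix_power A k $ l $ j))"
    by (simp add: matrix_matrix_mult_def norm_sum)
  also have "\<dots> \<le> (\<Sum>l\<in>(UNIV::'n set). K * (real CARD('n) * K) ^ k)"
    unfolding norm_mult by (intro sum_mono mult_mono entry Suc K) auto
  finally show ?case by (simp add: mult.assoc)
qed

lemma norm_trace_matrix_power_le:
  fixes A :: "complex^'n^'n"
  assumes "norm A \<le> K"
  shows "norm (trace (matrix_power A k)) \<le> real CARD('n) * (real CARD('n) * K) ^ k"
proof -
  have "norm (trace (matrix_power A k)) \<le> (\<Sum>i\<in>UNIV. norm (matrix_power A k $ i $ i))"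
    unfolding trace_def by (rule norm_sum)
  also have "\<dots> \<le> (\<Sum>i\<in>(UNIV::'n set). (real CARD('n) * K) ^ k)"
    by (intro sum_mono norm_matrix_power_entry_le assms)
  finally show ?thesis by simp
qed

lemma trace_matrix_exp:
  fixes A :: "complex^'n^'n"
  shows "trace (matrix_exp A) = (\<Sum>k. (1 / fact k) *\<^sub>R trace (matrix_power A k))"
proof -
  let ?f = "\<lambda>k. matrix_power A k /\<^sub>R fact k"
  have summ: "summable (\<lambda>k. ?f k $ i $ j)" for i j
  proof (rule summable_comparison_test[OF _ summable_exp[of "real CARD('n) * norm A"]], intro exI allI impI)
    fix k :: nat
    show "norm (?f k $ i $ j) \<le> inverse (fact k) * (real CARD('n) * norm A) ^ k"
      using norm_matrix_power_entry_le[of A "norm A" k i j]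
      by (simp add: mult_left_mono)
  qed
  have "?f sums (\<chi> i j. \<Sum>k. ?f k $ i $ j)"
    unfolding sums_def
  proof (intro vec_tendstoI)
    fix i j
    show "(\<lambda>n. (\<Sum>k<n. ?f k) $ i $ j) \<longlonglongrightarrow> (\<chi> i j. \<Sum>k. ?f k $ i $ j) $ i $ j"
      using summable_LIMSEQ[OF summ[of i j]] by (simp add: sum_component)
  qed
  then have "matrix_exp A = (\<chi> i j. \<Sum>k. ?f k $ i $ j)"
    unfolding matrix_exp_def by (rule sums_unique[symmetric])
  then have "trace (matrix_exp A) = (\<Sum>i\<in>UNIV. \<Sum>k. ?f k $ i $ i)"
    by (simp add: trace_def)
  also have "\<dots> = (\<Sum>k. \<Sum>i\<in>UNIV. ?f k $ i $ i)"
    by (rule suminf_sum[symmetric]) (rule summ)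
  also have "\<dots> = (\<Sum>k. (1 / fact k) *\<^sub>R trace (matrix_power A k))"
    by (simp add: trace_def scaleR_sum_right inverse_eq_divide)
  finally show ?thesis .
qed

lemma tendsto_matrix_mult:
  fixes f g :: "'b \<Rightarrow> complex^'n^'n"
  assumes "(f \<longlongrightarrow> A) F" "(g \<longlongrightarrow> B) F"
  shows "((\<lambda>x. f x ** g x) \<longlongrightarrow> A ** B) F"
  unfolding matrix_matrix_mult_def
  by (intro tendsto_vec_lambda tendsto_sum tendsto_mult tendsto_vec_nth assms)

lemma tendsto_trace_matrix_power:
  fixes f :: "'b \<Rightarrow> complex^'n^'n"
  assumes "(f \<longlongrightarrow> A) F"
  shows "((\<lambda>x. trace (matrix_power (f x) k)) \<longlongrightarrow> trace (matrix_power A k)) F"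
proof -
  have "((\<lambda>x. matrix_power (f x) k) \<longlongrightarrow> matrix_power A k) F"
    by (induction k) (auto intro: tendsto_matrix_mult assms)
  then show ?thesis
    unfolding trace_def by (intro tendsto_sum tendsto_vec_nth)
qed

text \<open>
  Dominated convergence for the exponential series: near the limit the norms of \<open>H x\<close> are bounded, so
  the terms are dominated by those of a scalar exponential series. The weights \<open>c\<close> allow the
  coefficients to vary too, which serves both the binomial expansion of \<open>(1 + H / m)\<^sup>m\<close> (varying
  weights) and continuity (constant weights).
\<close>

lemma tendsto_trace_matrix_exp_weighted:
  fixes H :: "'b \<Rightarrow> complex^'n^'n"
  assumes F: "F \<noteq> bot" and H: "(H \<longlongrightarrow> L) F"
    and c: "\<And>k. ((\<lambda>x. c k x) \<longlongrightarrow> 1 / fact k) F"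
    and c_le: "\<And>k x. \<bar>c k x\<bar> \<le> 1 / fact k"
  shows "((\<lambda>x. \<Sum>k. c k x *\<^sub>R trace (matrix_power (H x) k)) \<longlongrightarrow> trace (matrix_exp L)) F"
proof -
  let ?n = "real CARD('n)" and ?K = "norm L + 1"
  have bounded: "\<forall>\<^sub>F x in F. norm (H x) \<le> ?K"
    using order_tendstoD(2)[OF tendsto_norm[OF H], of ?K] by (auto elim: eventually_mono)
  have "\<forall>\<^sub>F (k, x) in at_top \<times>\<^sub>F F. norm (c k x *\<^sub>R trace (matrix_power (H x) k))
      \<le> ?n * (inverse (fact k) * (?n * ?K) ^ k)"
    unfolding eventually_prod_filter
  proof (intro exI conjI allI impI)
    show "\<forall>\<^sub>F k::nat in at_top. True" by simp
    show "\<forall>\<^sub>F x in F. norm (H x) \<le> ?K" by (rule bounded)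
    fix k :: nat and x assume "norm (H x) \<le> ?K"
    then have "\<bar>c k x\<bar> * norm (trace (matrix_power (H x) k))
        \<le> (1 / fact k) * (?n * (?n * ?K) ^ k)"
      by (intro mult_mono c_le norm_trace_matrix_power_le) auto
    then show "case (k, x) of (k, x) \<Rightarrow> norm (c k x *\<^sub>R trace (matrix_power (H x) k))
      \<le> ?n * (inverse (fact k) * (?n * ?K) ^ k)"
      by (simp add: field_simps)
  qed
  moreover have "summable (\<lambda>k. ?n * (inverse (fact k) * (?n * ?K) ^ k))"
    by (intro summable_mult summable_exp)
  ultimately show ?thesis
    unfolding trace_matrix_exp
    by (intro tannerys_theorem[THEN conjunct2, THEN conjunct2] F
        tendsto_scaleR c tendsto_trace_matrix_power H)
qed

lemma tendsto_binomial_div_power: "(\<lambda>m. real (m choose k) / real m ^ k) \<longlonglongrightarrow> 1 / fact k"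
proof (induction k)
  case 0
  show ?case by simp
next
  case (Suc k)
  have "\<forall>\<^sub>F m in sequentially. real (m choose k) / real m ^ k * ((1 - real k * (1 / real m)) / real (Suc k))
      = real (m choose Suc k) / real m ^ Suc k"
    using eventually_gt_at_top[of k]
  proof eventually_elim
    case (elim m)
    have "Suc k * (m choose Suc k) = (m - k) * (m choose k)"
      by (metis binomial_absorb_comp binomial_absorption mult.commute)
    then have "real (Suc k) * real (m choose Suc k) = (real m - real k) * real (m choose k)"
      using elim by (metis less_imp_le of_nat_diff of_nat_mult)
    then have "real (m choose Suc k) = (real m - real k) * real (m choose k) / real (Suc k)"
      by (simp add: field_simps)
    moreover have "1 - real k * (1 / real m) = (real m - real k) / real m"
      using elim by (simp add: field_simps)
    ultimately show ?case by (simp add: mult_ac)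
  qed
  moreover have "(\<lambda>m. real (m choose k) / real m ^ k * ((1 - real k * (1 / real m)) / real (Suc k)))
      \<longlonglongrightarrow> 1 / fact k * ((1 - real k * 0) / real (Suc k))"
    by (intro tendsto_intros Suc lim_1_over_n) auto
  ultimately show ?case
    by (auto intro: Lim_transform_eventually simp: mult.commute)
qed

text \<open>
  The binomial theorem turns the power into \<open>\<Sum>k. (m choose k) / m\<^sup>k H\<^sub>m\<^sup>k\<close>, where each weight is at
  most \<open>1 / k!\<close> and tends to \<open>1 / k!\<close>. Applied to \<open>H\<^sub>m = m (X\<^sub>m - 1)\<close> this is the product formula:
  only the first-order behaviour of the factor \<open>X\<^sub>m\<close> matters.
\<close>

lemma tendsto_trace_matrix_exp_product:
  fixes H :: "nat \<Rightarrow> complex^'n^'n"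
  assumes "H \<longlonglongrightarrow> L"
  shows "(\<lambda>m. trace (matrix_power (mat 1 + (1 / real m) *\<^sub>R H m) m)) \<longlonglongrightarrow> trace (matrix_exp L)"
proof -
  have le: "\<bar>real (m choose k) / real m ^ k\<bar> \<le> 1 / fact k" for k m
    \<comment> \<open>For \<open>m = 0 < k\<close> the weight is \<open>0 / 0 = 0\<close>.\<close>
  proof (cases "m = 0 \<and> k > 0")
    case False
    have "real (m choose k) * fact k \<le> real m ^ k"
      using binomial_fact_pow[of m k] by (metis of_nat_fact of_nat_le_iff of_nat_mult of_nat_power)
    then show ?thesis using False by (cases "m = 0") (auto simp: field_simps)
  qed (auto simp: binomial_eq_0)
  have "(\<Sum>k. (real (m choose k) / real m ^ k) *\<^sub>R trace (matrix_power (H m) k))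
      = trace (matrix_power (mat 1 + (1 / real m) *\<^sub>R H m) m)" for m
  proof -
    have "(\<Sum>k. (real (m choose k) / real m ^ k) *\<^sub>R trace (matrix_power (H m) k))
        = (\<Sum>k\<le>m. (real (m choose k) / real m ^ k) *\<^sub>R trace (matrix_power (H m) k))"
      by (rule suminf_finite) (auto simp: not_le)
    also have "\<dots> = trace (matrix_power (mat 1 + (1 / real m) *\<^sub>R H m) m)"
      by (simp add: matrix_power_one_plus trace_sum trace_scaleR matrix_power_scaleR
          power_divide scaleR_conv_of_real[where 'a=complex])
    finally show ?thesis .
  qed
  then show ?thesis
    using tendsto_trace_matrix_exp_weighted[OF _ assms, of "\<lambda>k m. real (m choose k) / real m ^ k"]
      tendsto_binomial_div_power le by simp
qed

lemma continuous_trace_matrix_exp: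
  fixes H :: "real \<Rightarrow> complex^'n^'n"
  assumes "continuous_on UNIV H"
  shows "continuous_on UNIV (\<lambda>t. trace (matrix_exp (H t)))"
proof -
  have "((\<lambda>t. trace (matrix_exp (H t))) \<longlongrightarrow> trace (matrix_exp (H s))) (at s)" for s
  proof -
    have "(H \<longlongrightarrow> H s) (at s)"
      using assms by (simp add: continuous_on_def)
    then show ?thesis
      using tendsto_trace_matrix_exp_weighted[of "at s" H "H s" "\<lambda>k x. 1 / fact k"]
      by (simp add: trace_matrix_exp)
  qed
  then show ?thesis by (simp add: continuous_on_def)
qed

section \<open>Positive semidefinite matrices\<close>

definition outer :: "complex^'n \<Rightarrow> complex^'n^'n" where
  "outer x = (\<chi> i j. x $ i * cnj (x $ j))"

lemma hermitian_outer: "hermitian_matrix (outer x)"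
  by (simp add: hermitian_matrix_def outer_def vec_eq_iff transpose_def)

lemma outer_mult_vector: "outer (X *v x) = X ** outer x ** adj X"
  by (simp add: outer_def vec_eq_iff transpose_def matrix_matrix_mult_def matrix_vector_mult_def
      sum_product sum_distrib_right sum_distrib_left mult_ac)

text \<open>
  The trace form of \<open>P X P = trace (X P) P\<close> for \<open>P = v v\<^sup>*\<close>: this is how rank one makes traces factor.
\<close>

lemma trace_outer_sandwich:
  "trace (S ** outer v ** T ** outer v) = trace (S ** outer v) * trace (T ** outer v)"
proof -
  let ?q = "\<lambda>X. \<Sum>k\<in>UNIV. \<Sum>l\<in>UNIV. cnj (v $ k) * X $ k $ l * v $ l"
  have trace_eq: "trace (X ** outer v) = ?q X" for X
    by (simp add: trace_def matrix_matrix_mult_def outer_def mult_ac)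
  define q where "q = ?q T"
  have [simp]: "(T ** outer v) $ k $ j = (T *v v) $ k * cnj (v $ j)" for k j
    by (simp add: matrix_matrix_mult_def matrix_vector_mult_def outer_def sum_distrib_right sum_distrib_left mult_ac)
  have "(outer v ** (T ** outer v)) $ i $ j = q * outer v $ i $ j" for i j
    by (simp add: matrix_matrix_mult_def[of "outer v"])
      (simp add: outer_def q_def matrix_vector_mult_def sum_distrib_right sum_distrib_left mult_ac)
  then have "(S ** (outer v ** (T ** outer v))) $ i $ j = q * (S ** outer v) $ i $ j" for i j
    by (simp add: matrix_matrix_mult_def[of S] sum_distrib_left mult_ac)
  then have "trace (S ** (outer v ** (T ** outer v))) = q * trace (S ** outer v)"
    by (simp add: trace_def sum_distrib_left)
  then show ?thesis
    by (simp add: trace_eq q_def matrix_mul_assoc)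
qed

text \<open>
  The number \<^term>\<open>trace (S ** outer x)\<close> is the quadratic form \<open>x\<^sup>* S x\<close>. Writing it as a trace
  reduces congruence and factorisation to cyclicity of the trace.
\<close>

definition psd :: "complex^'n^'n \<Rightarrow> bool" where
  "psd S \<longleftrightarrow> (\<forall>x. trace (S ** outer x) \<in> \<real>\<^sub>\<ge>\<^sub>0)"

lemma nonneg_Reals_sum: "(\<And>k. k \<in> K \<Longrightarrow> f k \<in> \<real>\<^sub>\<ge>\<^sub>0) \<Longrightarrow> (\<Sum>k\<in>K. f k) \<in> \<real>\<^sub>\<ge>\<^sub>0"
  by (induction K rule: infinite_finite_induct) auto

lemma mult_cnj_nonneg: "z * cnj z \<in> \<real>\<^sub>\<ge>\<^sub>0"
  by (simp add: complex_mult_cnj complex_nonneg_Reals_iff)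

lemma psd_mat_1: "psd (mat 1)"
  by (simp add: psd_def trace_def outer_def nonneg_Reals_sum mult_cnj_nonneg)

lemma psd_congruence:
  assumes "psd S"
  shows "psd (adj X ** S ** X)"
  unfolding psd_def
proof
  fix x
  have "trace (adj X ** S ** X ** outer x) = trace (adj X ** (S ** X ** outer x))"
    by (simp add: matrix_mul_assoc)
  also have "\<dots> = trace (S ** X ** outer x ** adj X)"
    by (rule trace_mul_sym)
  also have "\<dots> = trace (S ** outer (X *v x))"
    by (simp add: outer_mult_vector matrix_mul_assoc)
  finally show "trace (adj X ** S ** X ** outer x) \<in> \<real>\<^sub>\<ge>\<^sub>0"
    using assms by (simp add: psd_def)
qed

lemma psd_trace:
  assumes "psd S"
  shows "trace S \<in> \<real>\<^sub>\<ge>\<^sub>0"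
proof -
  have "S $ i $ i = trace (S ** outer (axis i 1))" for i
  proof -
    have "trace (S ** outer (axis i 1)) = (\<Sum>k\<in>UNIV. if k = i then S $ k $ i else 0)"
      unfolding trace_def
      by (rule sum.cong)
        (auto simp: matrix_matrix_mult_def outer_def axis_def if_distrib[of cnj] cong: if_cong,
         auto simp: if_distrib[of "\<lambda>x. _ * x"] cong: if_cong)
    then show ?thesis by simp
  qed
  then show ?thesis
    using assms unfolding trace_def[of S] by (auto simp: psd_def intro: nonneg_Reals_sum)
qed

text \<open>
  The product \<open>C Q C \<dots> Q C\<close> is a palindrome, so \<open>C (Q C)\<^bsup>l+2\<^esup>\<close> arises from \<open>C (Q C)\<^sup>l\<close> by the congruence
  with \<open>Q C\<close>. The induction therefore goes in steps of two, starting from \<open>C\<close> and \<open>C Q C\<close>.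
\<close>

lemma psd_alternating_power:
  assumes C: "hermitian_matrix C" "psd C" and Q: "hermitian_matrix Q" "psd Q"
  shows "psd (C ** matrix_power (Q ** C) l)"
proof (induction l rule: nat_induct2)
  case 0
  show ?case using C by simp
next
  case 1
  show ?case using psd_congruence[OF Q(2), of C] C by (simp add: hermitian_matrix_def matrix_mul_assoc)
next
  case (step l)
  have "adj (Q ** C) = C ** Q"
    using C Q by (simp add: adj_mult hermitian_matrix_def)
  then have "adj (Q ** C) ** (C ** matrix_power (Q ** C) l) ** (Q ** C)
      = C ** (Q ** C) ** (matrix_power (Q ** C) l ** (Q ** C))"
    by (simp add: matrix_mul_assoc)
  also have "\<dots> = C ** matrix_power (Q ** C) (l + 2)"
  proof -
    have "matrix_power (Q ** C) (l + 2) = (Q ** C) ** (matrix_power (Q ** C) l ** (Q ** C))"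
      by (simp flip: matrix_power_Suc_right)
    then show ?thesis by (simp only: matrix_mul_assoc)
  qed
  finally show ?case
    using psd_congruence[OF step, of "Q ** C"] by simp
qed

text \<open>
  These are the words without \<open>P\<close>. Doubling the leading \<open>Q\<close> and rotating one copy to the end shows that
  \<open>(Q C)\<^sup>l\<close> has the same trace as the palindrome \<open>Q (C Q \<dots> C) Q\<close>.
\<close>

lemma trace_projection_power_nonneg:
  assumes C: "hermitian_matrix C" "psd C" and Q: "hermitian_matrix Q" "psd Q" "Q ** Q = Q"
  shows "trace (matrix_power (Q ** C) l) \<in> \<real>\<^sub>\<ge>\<^sub>0"
proof (cases l)
  case 0
  then show ?thesis using psd_trace[OF psd_mat_1] by simp
next
  case (Suc k)
  let ?S = "C ** matrix_power (Q ** C) k"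
  have "trace (matrix_power (Q ** C) l) = trace (Q ** (Q ** ?S))"
    using Q(3) by (simp add: Suc matrix_mul_assoc)
  also have "\<dots> = trace (Q ** ?S ** Q)"
    by (rule trace_mul_sym)
  also have "\<dots> = trace (adj Q ** ?S ** Q)"
    using Q(1) by (simp add: hermitian_matrix_def)
  finally show ?thesis
    using psd_trace[OF psd_congruence[OF psd_alternating_power[OF C Q(1,2)]]] by metis
qed

section \<open>Exponentially convex kernels\<close>

definition exp_convex_kernel :: "(real \<Rightarrow> complex) \<Rightarrow> bool" where
  "exp_convex_kernel f \<longleftrightarrow> (\<forall>(N::nat) (t :: nat \<Rightarrow> real) (\<xi> :: nat \<Rightarrow> complex).
     (\<Sum>r=1..N. \<Sum>s=1..N. f (t r + t s) * \<xi> r * cnj (\<xi> s)) \<in> \<real>\<^sub>\<ge>\<^sub>0)"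

lemma exp_convex_kernel_const:
  assumes "c \<in> \<real>\<^sub>\<ge>\<^sub>0"
  shows "exp_convex_kernel (\<lambda>_. c)"
  unfolding exp_convex_kernel_def
proof (intro allI)
  fix N :: nat and t :: "nat \<Rightarrow> real" and \<xi> :: "nat \<Rightarrow> complex"
  have "(\<Sum>r=1..N. \<Sum>s=1..N. c * \<xi> r * cnj (\<xi> s)) = c * ((\<Sum>r=1..N. \<xi> r) * cnj (\<Sum>r=1..N. \<xi> r))"
    unfolding cnj_sum sum_product by (simp add: sum_distrib_left mult.assoc)
  then show "(\<Sum>r=1..N. \<Sum>s=1..N. c * \<xi> r * cnj (\<xi> s)) \<in> \<real>\<^sub>\<ge>\<^sub>0"
    using assms mult_cnj_nonneg by (metis nonneg_Reals_mult_I)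
qed

lemma exp_convex_kernel_add:
  "exp_convex_kernel f \<Longrightarrow> exp_convex_kernel g \<Longrightarrow> exp_convex_kernel (\<lambda>t. f t + g t)"
  by (simp add: exp_convex_kernel_def distrib_right sum.distrib)

lemma exp_convex_kernel_cmult:
  "c \<in> \<real>\<^sub>\<ge>\<^sub>0 \<Longrightarrow> exp_convex_kernel f \<Longrightarrow> exp_convex_kernel (\<lambda>t. c * f t)"
  by (simp add: exp_convex_kernel_def mult.assoc flip: sum_distrib_left)

text \<open>
  The exponential is absorbed into the test vector, as \<open>exp (h (t\<^sub>r + t\<^sub>s))\<close> splits into factors that
  rescale \<open>\<xi> r\<close> and \<open>\<xi> s\<close>.
\<close>

lemma exp_convex_kernel_exp_mult:
  assumes "exp_convex_kernel f"
  shows "exp_convex_kernel (\<lambda>t. of_real (exp (h * t)) * f t)"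
  unfolding exp_convex_kernel_def
proof (intro allI)
  fix N :: nat and t :: "nat \<Rightarrow> real" and \<xi> :: "nat \<Rightarrow> complex"
  have "(\<Sum>r=1..N. \<Sum>s=1..N. f (t r + t s) * (of_real (exp (h * t r)) * \<xi> r) * cnj (of_real (exp (h * t s)) * \<xi> s)) \<in> \<real>\<^sub>\<ge>\<^sub>0"
    using assms unfolding exp_convex_kernel_def
    by (elim allE[where x=N] allE[where x=t] allE[where x="\<lambda>r. of_real (exp (h * t r)) * \<xi> r"])
  then show "(\<Sum>r=1..N. \<Sum>s=1..N. of_real (exp (h * (t r + t s))) * f (t r + t s) * \<xi> r * cnj (\<xi> s)) \<in> \<real>\<^sub>\<ge>\<^sub>0"
    by (simp add: distrib_left exp_add mult_ac)
qed

lemma exp_convex_kernel_limit: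
  assumes "\<And>m. exp_convex_kernel (f m)" and "\<And>t. (\<lambda>m. f m t) \<longlonglongrightarrow> g t"
  shows "exp_convex_kernel g"
  unfolding exp_convex_kernel_def
proof (intro allI)
  fix N :: nat and t :: "nat \<Rightarrow> real" and \<xi> :: "nat \<Rightarrow> complex"
  have "(\<lambda>m. \<Sum>r=1..N. \<Sum>s=1..N. f m (t r + t s) * \<xi> r * cnj (\<xi> s))
      \<longlonglongrightarrow> (\<Sum>r=1..N. \<Sum>s=1..N. g (t r + t s) * \<xi> r * cnj (\<xi> s))"
    by (intro tendsto_intros assms)
  then show "(\<Sum>r=1..N. \<Sum>s=1..N. g (t r + t s) * \<xi> r * cnj (\<xi> s)) \<in> \<real>\<^sub>\<ge>\<^sub>0"
    by (rule closed_sequentially[OF closed_nonneg_Reals_complex, rotated]) (use assms in \<open>simp add: exp_convex_kernel_def\<close>)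
qed

lemma exp_convex_kernel_nonneg:
  assumes "exp_convex_kernel f"
  shows "f t \<in> \<real>\<^sub>\<ge>\<^sub>0"
  using assms[unfolded exp_convex_kernel_def, rule_format, of "\<lambda>_. t / 2" "\<lambda>_. 1" 1] by simp

section \<open>The approximating products\<close>

text \<open>
  With \<open>N = Q C\<close> and \<open>g\<^bsub>l,j\<^esub> = trace (C N\<^sup>l M\<^sup>j P)\<close>, splitting the first factor of \<open>M\<^bsup>j+1\<^esup>\<close> as \<open>M = z P C + N\<close>
  and factoring at the new \<open>P\<close> yields the recursion
  \<open>g\<^bsub>l,j+1\<^esub> = g\<^bsub>l+1,j\<^esub> + trace (C N\<^sup>l P) z g\<^bsub>0,j\<^esub>\<close>, whose coefficients are nonnegative. The exponent \<open>l\<close>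
  counts the factors already processed since the last \<open>P\<close>.
\<close>

lemma exp_convex_kernel_corner:
  fixes C Q :: "complex^'n^'n" and v :: "complex^'n" and h :: real
  assumes C: "hermitian_matrix C" "psd C" and Q: "hermitian_matrix Q" "psd Q"
  defines "M \<equiv> \<lambda>t. exp (h * t) *\<^sub>R (outer v ** C) + Q ** C"
  shows "exp_convex_kernel (\<lambda>t. trace (C ** matrix_power (Q ** C) l ** matrix_power (M t) j ** outer v))"
proof (induction j arbitrary: l)
  case 0
  show ?case
    using psd_alternating_power[OF assms(1-4)] by (auto simp: psd_def intro: exp_convex_kernel_const)
next
  case (Suc j)
  let ?S = "\<lambda>l. C ** matrix_power (Q ** C) l"
  have "trace (?S l ** matrix_power (M t) (Suc j) ** outer v)
      = trace (?S (Suc l) ** matrix_power (M t) j ** outer v)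
        + trace (?S l ** outer v) * (of_real (exp (h * t)) * trace (?S 0 ** matrix_power (M t) j ** outer v))"
    for t
  proof -
    have "?S l ** M t = ?S (Suc l) + exp (h * t) *\<^sub>R (?S l ** outer v ** C)"
      by (simp add: M_def matrix_add_ldistrib matrix_mult_scaleR matrix_mul_assoc add.commute
          matrix_power_Suc_right del: matrix_power_Suc)
    then have "?S l ** matrix_power (M t) (Suc j) ** outer v
        = ?S (Suc l) ** matrix_power (M t) j ** outer v
          + exp (h * t) *\<^sub>R (?S l ** outer v ** (C ** matrix_power (M t) j) ** outer v)"
      by (simp add: matrix_mul_assoc matrix_add_rdistrib matrix_mult_scaleR)
    then show ?thesis
      by (simp add: trace_add trace_scaleR trace_outer_sandwich)
  qed
  moreover have "trace (?S l ** outer v) \<in> \<real>\<^sub>\<ge>\<^sub>0"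
    using psd_alternating_power[OF assms(1-4)] by (simp add: psd_def)
  ultimately show ?case
    by (simp only:) (intro exp_convex_kernel_add exp_convex_kernel_cmult exp_convex_kernel_exp_mult Suc)
qed

text \<open>
  Here the last factor of \<open>M\<^bsup>j+1\<^esup>\<close> is split. If it contributes \<open>N = Q C\<close>, the trailing power grows; if it
  contributes \<open>z P C\<close>, cyclicity brings the trace into the form treated in the previous lemma. The extra
  factor \<open>(Q C)\<^sup>l\<close> is what makes the induction close; the case \<open>l = 0\<close> is the one of interest.
\<close>

lemma exp_convex_kernel_trace_power:
  fixes C Q :: "complex^'n^'n" and v :: "complex^'n" and h :: real
  assumes C: "hermitian_matrix C" "psd C" and Q: "hermitian_matrix Q" "psd Q" "Q ** Q = Q"
  defines "M \<equiv> \<lambda>t. exp (h * t) *\<^sub>R (outer v ** C) + Q ** C"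
  shows "exp_convex_kernel (\<lambda>t. trace (matrix_power (M t) j ** matrix_power (Q ** C) l))"
proof (induction j arbitrary: l)
  case 0
  show ?case
    using trace_projection_power_nonneg[OF assms(1-5)] by (auto intro: exp_convex_kernel_const)
next
  case (Suc j)
  let ?N = "matrix_power (Q ** C)"
  have "trace (matrix_power (M t) (Suc j) ** ?N l)
      = trace (matrix_power (M t) j ** ?N (Suc l))
        + of_real (exp (h * t)) * trace (C ** ?N l ** matrix_power (M t) j ** outer v)"
    for t
  proof -
    have "matrix_power (M t) (Suc j) ** ?N l = matrix_power (M t) j ** (M t ** ?N l)"
      unfolding matrix_power_Suc_right by (simp add: matrix_mul_assoc)
    also have "M t ** ?N l = ?N (Suc l) + exp (h * t) *\<^sub>R (outer v ** (C ** ?N l))"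
      by (simp add: M_def matrix_add_rdistrib matrix_mul_assoc matrix_mult_scaleR add.commute)
    finally have "trace (matrix_power (M t) (Suc j) ** ?N l) = trace (matrix_power (M t) j ** ?N (Suc l))
        + of_real (exp (h * t)) * trace ((matrix_power (M t) j ** outer v) ** (C ** ?N l))"
      by (simp add: matrix_add_ldistrib matrix_mult_scaleR trace_add trace_scaleR matrix_mul_assoc
          del: matrix_power_Suc)
    then show ?thesis
      using trace_mul_sym[of "matrix_power (M t) j ** outer v" "C ** ?N l"]
      by (simp add: matrix_mul_assoc)
  qed
  moreover have "exp_convex_kernel (\<lambda>t. trace (C ** ?N l ** matrix_power (M t) j ** outer v))"
    unfolding M_def by (rule exp_convex_kernel_corner[OF assms(1-4)])
  ultimately show ?case
    by (simp only:) (intro exp_convex_kernel_add exp_convex_kernel_exp_mult Suc.IH)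
qed

section \<open>Hermitian matrices of rank one\<close>

text \<open>
  All rows are multiples of one vector \<open>w\<close>, so the entries are \<open>c\<^sub>i w\<^sub>j\<close>. Comparing with the conjugate
  transpose in a column \<open>p\<close> where \<open>w\<close> does not vanish forces \<open>c\<^sub>i = d cnj w\<^sub>i\<close> with one number \<open>d\<close>, and the
  diagonal entry at \<open>p\<close> shows that \<open>d\<close> is real. Normalising the conjugate of \<open>w\<close> gives \<open>v\<close>.
\<close>

lemma hermitian_rank_one:
  fixes A :: "complex^'n^'n"
  assumes A: "hermitian_matrix A" and rank: "rank A = 1"
  obtains a v where "A = a *\<^sub>R outer v" and "trace (outer v) = 1"
proof -
  obtain W where W: "vec.independent W" "rows A \<subseteq> vec.span W" "card W = 1"
    using vec.basis_exists[of "rows A"] rank unfolding row_rank_def_gen by metis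
  then obtain w where w: "W = {w}" by (auto simp: card_1_singleton_iff)
  have "w \<noteq> 0" using W(1) w vec.dependent_zero by auto
  then obtain p where p: "w $ p \<noteq> 0" by (auto simp: vec_eq_iff)
  have "\<exists>c. row i A = c *s w" for i
    using W(2) w by (auto simp: rows_def vec.span_singleton)
  then obtain c where "\<And>i. row i A = c i *s w" by metis
  then have entry: "A $ i $ j = c i * w $ j" for i j
    by (auto simp: row_def vec_eq_iff)
  have herm: "c i * w $ j = cnj (c j * w $ i)" for i j
    using A by (simp add: hermitian_matrix_def vec_eq_iff transpose_def flip: entry)
  define d where "d = cnj (c p) / w $ p"
  have c: "c i = d * cnj (w $ i)" for i
    using herm[of i p] p by (simp add: d_def field_simps)
  have "d = cnj d"
    using herm[of p p] p by (simp add: c)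
  then obtain e where e: "d = of_real e" by (metis Reals_cases Reals_cnj_iff)
  define s where "s = (\<Sum>i\<in>UNIV. (cmod (w $ i))\<^sup>2)"
  have s: "s > 0"
    unfolding s_def using p by (intro sum_pos2[of _ p]) auto
  define v where "v = (\<chi> i. cnj (w $ i) / of_real (sqrt s))"
  have sq: "complex_of_real (sqrt s) * complex_of_real (sqrt s) = of_real s"
    using s by (simp flip: of_real_mult)
  have "trace (outer v) = (\<Sum>i\<in>UNIV. of_real ((cmod (w $ i))\<^sup>2) / of_real s)"
    unfolding complex_norm_square using sq by (simp add: trace_def outer_def v_def mult.commute)
  also have "\<dots> = of_real s / of_real s"
    unfolding sum_divide_distrib[symmetric] of_real_sum[symmetric] s_def ..
  also have "\<dots> = 1"
    using s by simp
  finally have "trace (outer v) = 1" .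
  moreover have "A = (e * s) *\<^sub>R outer v"
    using sq s by (simp add: vec_eq_iff entry c outer_def v_def e scaleR_conv_of_real[where 'a=complex])
  ultimately show thesis using that by blast
qed

lemma outer_idempotent:
  assumes "trace (outer v) = 1"
  shows "outer v ** outer v = outer v"
proof -
  have "(\<Sum>k\<in>UNIV. v $ k * cnj (v $ k)) = 1"
    using assms by (simp add: trace_def outer_def)
  moreover have "(outer v ** outer v) $ i $ j = (v $ i * cnj (v $ j)) * (\<Sum>k\<in>UNIV. v $ k * cnj (v $ k))" for i j
    by (simp add: matrix_matrix_mult_def outer_def sum_distrib_left mult_ac)
  ultimately show ?thesis by (simp add: vec_eq_iff outer_def)
qed

section \<open>Passage to the limit\<close>

lemma tendsto_exp_difference_quotient: "(\<lambda>m. real m * (exp (x / real m) - 1)) \<longlonglongrightarrow> x"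
proof (cases "x = 0")
  case False
  have "((\<lambda>y. (exp y - 1) / y) \<longlongrightarrow> 1) (at (0::real))"
    using DERIV_exp[of "0::real"] by (simp add: DERIV_def)
  moreover have "filterlim (\<lambda>m. x / real m) (at 0) sequentially"
    unfolding filterlim_at
    using False tendsto_mult[OF tendsto_const[of x] lim_1_over_n]
    by (auto intro: eventually_mono[OF eventually_gt_at_top[of 0]])
  ultimately have "(\<lambda>m. x * ((exp (x / real m) - 1) / (x / real m))) \<longlonglongrightarrow> x * 1"
    by (intro tendsto_mult tendsto_const) (rule filterlim_compose)
  then show ?thesis using False by (simp add: mult.commute)
qed simp

text \<open>
  The factor \<open>M\<close> below is \<open>exp (t a P / m) C\<close>. Taking \<open>C\<close> as the square of a Hermitian matrix makes it
  positive semidefinite for every \<open>m\<close>, while \<open>m (C - 1)\<close> still tends to \<open>B\<close>.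
\<close>

lemma exp_convex_kernel_trace_exp:
  fixes B :: "complex^'n^'n"
  assumes B: "hermitian_matrix B" and v: "trace (outer v) = 1"
  shows "exp_convex_kernel (\<lambda>t. trace (matrix_exp (t *\<^sub>R (a *\<^sub>R outer v) + B)))"
proof (rule exp_convex_kernel_limit)
  define P where "P = outer v"
  define Q where "Q = mat 1 - P"
  \<comment> \<open>A square root of \<open>exp (B / m)\<close> to first order, squared.\<close>
  define C where "C = (\<lambda>m. (mat 1 + (1 / (2 * real m)) *\<^sub>R B) ** (mat 1 + (1 / (2 * real m)) *\<^sub>R B))"
  define M where "M = (\<lambda>m t. exp (a / real m * t) *\<^sub>R (P ** C m) + Q ** C m)"
  have PQ: "P + Q = mat 1" by (simp add: Q_def)
  have PP: "P ** P = P" by (simp add: P_def outer_idempotent v)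
  have "P ** Q = 0" using matrix_add_ldistrib[of P P Q] PP PQ by simp
  then have QQ: "Q ** Q = Q" using matrix_add_rdistrib[of P Q Q] PQ by simp
  have herm_Q: "hermitian_matrix Q"
    by (simp add: Q_def P_def hermitian_minus hermitian_mat_1 hermitian_outer)
  have psd_Q: "psd Q"
    using psd_congruence[OF psd_mat_1, of Q] herm_Q QQ by (simp add: hermitian_matrix_def)
  have herm_D: "hermitian_matrix (mat 1 + (1 / (2 * real m)) *\<^sub>R B)" for m
    by (intro hermitian_add hermitian_scaleR hermitian_mat_1 B)
  have psd_C: "psd (C m)" for m
    using psd_congruence[OF psd_mat_1] herm_D[of m] by (metis C_def hermitian_matrix_def matrix_mul_rid)
  have herm_C: "hermitian_matrix (C m)" for m
    using herm_D[of m] by (simp add: C_def hermitian_matrix_def adj_mult)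
  show "exp_convex_kernel (\<lambda>t. trace (matrix_power (M m t) m))" for m
    using exp_convex_kernel_trace_power[OF herm_C psd_C herm_Q psd_Q QQ,
        where h = "a / real m" and v = v and j = m and l = 0]
    by (simp add: M_def P_def)
  show "(\<lambda>m. trace (matrix_power (M m t) m)) \<longlonglongrightarrow> trace (matrix_exp (t *\<^sub>R (a *\<^sub>R outer v) + B))" for t
  proof -
    \<comment> \<open>Written so that \<open>M = 1 + H / m\<close>, with \<open>H\<close> tending to \<open>t a P + B\<close>.\<close>
    define w where "w = (\<lambda>m. real m * (exp (a * t / real m) - 1))"
    define H where "H = (\<lambda>m. w m *\<^sub>R (P ** C m) + B + (1 / real m) *\<^sub>R ((1 / 4) *\<^sub>R (B ** B)))"
    have C_eq: "C m = mat 1 + (1 / real m) *\<^sub>R B + (1 / real m) *\<^sub>R ((1 / real m) *\<^sub>R ((1 / 4) *\<^sub>R (B ** B)))" for m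
    proof -
      define h where "h = 1 / (2 * real m)"
      have C_h: "C m = mat 1 + (h *\<^sub>R B + h *\<^sub>R B) + (h * h) *\<^sub>R (B ** B)"
        unfolding C_def h_def[symmetric]
        by (simp add: matrix_add_ldistrib matrix_add_rdistrib matrix_mult_scaleR
            scaleR_add_right add.assoc)
      have h_plus_h: "h *\<^sub>R B + h *\<^sub>R B = (1 / real m) *\<^sub>R B"
        by (simp add: h_def flip: scaleR_add_left)
      show ?thesis unfolding C_h h_plus_h by (simp add: h_def)
    qed
    have M_eq: "M m t = mat 1 + (1 / real m) *\<^sub>R H m" if "m > 0" for m
    proof -
      have "M m t = (exp (a * t / real m) - 1) *\<^sub>R (P ** C m) + (P + Q) ** C m"
        by (simp add: M_def matrix_add_rdistrib scaleR_diff_left)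
      also have "exp (a * t / real m) - 1 = (1 / real m) * w m"
        using that by (simp add: w_def)
      finally show ?thesis
        by (simp add: PQ H_def scaleR_add_right) (simp add: C_eq algebra_simps)
    qed
    have small: "(\<lambda>m. (1 / real m) *\<^sub>R X) \<longlonglongrightarrow> 0" for X :: "complex^'n^'n"
      using tendsto_scaleR[OF lim_1_over_n tendsto_const, of X] by simp
    have smaller: "(\<lambda>m. (1 / real m) *\<^sub>R ((1 / real m) *\<^sub>R X)) \<longlonglongrightarrow> 0" for X :: "complex^'n^'n"
      using tendsto_scaleR[OF lim_1_over_n small, of X] by simp
    have "C \<longlonglongrightarrow> mat 1 + 0 + 0"
      unfolding C_eq by (intro tendsto_add tendsto_const small smaller)
    then have "(\<lambda>m. P ** C m) \<longlonglongrightarrow> P ** (mat 1 + 0 + 0)"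
      by (intro tendsto_matrix_mult tendsto_const)
    moreover have "w \<longlonglongrightarrow> a * t"
      unfolding w_def by (rule tendsto_exp_difference_quotient)
    ultimately have "H \<longlonglongrightarrow> (a * t) *\<^sub>R (P ** (mat 1 + 0 + 0)) + B + 0"
      unfolding H_def by (intro tendsto_add tendsto_scaleR tendsto_const small)
    then have "H \<longlonglongrightarrow> t *\<^sub>R (a *\<^sub>R outer v) + B"
      by (simp add: P_def mult.commute)
    from tendsto_trace_matrix_exp_product[OF this]
    show ?thesis
      by (rule Lim_transform_eventually) (auto intro: eventually_mono[OF eventually_gt_at_top[of 0]] simp: M_eq)
  qed
qed

theorem theorem3p3:
  fixes A B :: "complex^'n^'n"
  assumes "hermitian_matrix A" and "hermitian_matrix B"
    and "rank A = 1"
  shows "(\<forall>t::real. trace (matrix_exp (t *\<^sub>R A + B)) \<in> \<real>) \<and>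
    exponentially_convex (\<lambda>t. Re (trace (matrix_exp (t *\<^sub>R A + B))))"
proof -
  define f where "f = (\<lambda>t. trace (matrix_exp (t *\<^sub>R A + B)))"
  obtain a v where "A = a *\<^sub>R outer v" "trace (outer v) = 1"
    using hermitian_rank_one assms by blast
  then have kernel: "exp_convex_kernel f"
    using exp_convex_kernel_trace_exp[OF assms(2), of v a] by (simp add: f_def)
  have nonneg: "f t \<in> \<real>\<^sub>\<ge>\<^sub>0" for t
    by (rule exp_convex_kernel_nonneg[OF kernel])
  have real: "of_real (Re (f t)) = f t" for t
    using nonneg[of t] by (simp add: complex_nonneg_Reals_iff complex_eq_iff)
  have "continuous_on UNIV f"
    unfolding f_def by (intro continuous_trace_matrix_exp continuous_intros)
  then have "continuous_on UNIV (\<lambda>t. Re (f t))"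
    by (intro continuous_intros)
  then have "exponentially_convex (\<lambda>t. Re (f t))"
    using nonneg kernel
    by (simp add: exponentially_convex_def exp_convex_kernel_def real complex_nonneg_Reals_iff)
  then show ?thesis
    using nonneg by (auto simp: f_def)
qed

end
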